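(* Let $k,s,t$ be positive integers with $s\ge 2$ and set $q=(k-1)\sum_{n=0}^{t}k^{-s-2n}$. Then $(k^{s-2},\;(k^{s-2}+k+1)k^{2t+2},\;k+1)$ is a length $3$ half-relation for $q$.
   Context: For $q\in\mathbb{R}$ let $A=\begin{pmatrix}1&1\\0&1\end{pmatrix}$ and $B_q=\begin{pmatrix}1&0\\ q&1\end{pmatrix}$. A tuple $(a_1,a_2,a_3)\in\mathbb{Z}^3$ with all $a_i\neq 0$ is a (length $3$) half-relation for $q$ if the matrix $M=A^{a_1}B_q^{a_2}A^{a_3}$ satisfies $q\,c_{12}(M)-c_{21}(M)=0$, where $c_{ij}(M)$ is the $(i,j)$ entry of $M$. *)

theory Defs
  imports "HOL-Analysis.Analysis"
begin

definition mat_A :: "real^2^2" where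
  "mat_A = vector [vector [1, 1], vector [0, 1]]"

definition mat_B :: "real \<Rightarrow> real^2^2" where
  "mat_B q = vector [vector [1, 0], vector [q, 1]]"

(* Powers with respect to the matrix product **; the overloaded operators * and ^
   on vectors are componentwise and hence not usable here. A negative exponent is
   meant for invertible matrices only. *)
definition mat_int_pow :: "real^'n^'n \<Rightarrow> int \<Rightarrow> real^'n^'n" where
  "mat_int_pow M a =
     (if 0 \<le> a then (((**) M) ^^ nat a) (mat 1)
      else (((**) (matrix_inv M)) ^^ nat (- a)) (mat 1))"

definition half_relation3 :: "real \<Rightarrow> int \<times> int \<times> int \<Rightarrow> bool" where
  "half_relation3 q = (\<lambda>(a1, a2, a3).
     a1 \<noteq> 0 \<and> a2 \<noteq> 0 \<and> a3 \<noteq> 0 \<and>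
     (let M = mat_int_pow mat_A a1 ** mat_int_pow (mat_B q) a2 ** mat_int_pow mat_A a3
      in q * M $ 1 $ 2 - M $ 2 $ 1 = 0))"

end

theory Submission
  imports Defs
begin

text \<open>
  Multiplying out, \<open>M = A\<^sup>a B\<^sub>q\<^sup>b A\<^sup>c\<close> has \<open>M\<^sub>1\<^sub>2 = a + c + a b c q\<close> and \<open>M\<^sub>2\<^sub>1 = q b\<close>, so the tuple
  \<open>(a, b, c)\<close> is a half-relation as soon as \<open>a + c + a b c q = b\<close>.

  The point of the choice \<open>c = k + 1\<close> is that it turns the factor \<open>k - 1\<close> of \<open>q\<close> into \<open>k\<^sup>2 - 1\<close>,
  which makes the geometric sum with ratio \<open>k\<^sup>-\<^sup>2\<close> telescope (\<open>geometric_powi_telescope\<close>); the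
  choice \<open>a = k\<^sup>s\<^sup>-\<^sup>2\<close> then normalises the leading term to \<open>1\<close>. With \<open>K = k\<^bsup>2t+2\<^esup>\<close> the result is
  \<open>a c q = 1 - 1 / K\<close>, and \<open>b = (a + c) K\<close> is precisely the solution of
  \<open>a + c = b (1 - a c q) = b / K\<close>.
\<close>

lemma mat_A_funpow:
  "(((**) mat_A) ^^ n) (mat 1) = vector [vector [1, real n], vector [0, 1]]"
  by (induction n)
    (simp_all add: mat_A_def vec_eq_iff forall_2 mat_def matrix_matrix_mult_def sum_2)

lemma mat_B_funpow:
  "(((**) (mat_B q)) ^^ n) (mat 1) = vector [vector [1, 0], vector [real n * q, 1]]"
  by (induction n)
    (simp_all add: mat_B_def vec_eq_iff forall_2 mat_def matrix_matrix_mult_def sum_2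
      algebra_simps)

text \<open>
  The quantity \<open>q M\<^sub>1\<^sub>2 - M\<^sub>2\<^sub>1\<close> is \<open>q\<close> times the difference of the two sides of the last assumption.
  Positive exponents keep the matrix powers free of \<^const>\<open>matrix_inv\<close>.
\<close>

lemma half_relation3I:
  fixes a b c :: int and q :: real
  assumes "a > 0" "b > 0" "c > 0"
    and "real_of_int a + real_of_int c
      + real_of_int a * real_of_int b * real_of_int c * q = real_of_int b"
  shows "half_relation3 q (a, b, c)"
proof -
  have "q * (real_of_int a + real_of_int c
      + real_of_int a * real_of_int b * real_of_int c * q) - q * real_of_int b = 0"
    unfolding assms(4) by simp
  then show ?thesis
    using assms(1-3)
    by (simp add: half_relation3_def mat_int_pow_def mat_A_funpow mat_B_funpow
        matrix_matrix_mult_def sum_2 algebra_simps)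
qed

text \<open>
  Since \<open>(x\<^sup>2 - 1) x\<^sup>e = x\<^bsup>e+2\<^esup> - x\<^sup>e\<close> and the exponents fall in steps of \<open>2\<close>, neighbouring terms cancel.
  Keeping the factor \<open>x\<^sup>2 - 1\<close> on the left, instead of dividing by it, covers \<open>x = 1\<close> as well.
\<close>

lemma geometric_powi_telescope:
  fixes x :: "'a :: field" and m :: int
  assumes "x \<noteq> 0"
  shows "(x\<^sup>2 - 1) * (\<Sum>n=0..t. x powi (m - 2 * int n)) = x powi (m + 2) - x powi (m - 2 * int t)"
proof (induction t)
  case 0
  then show ?case
    using assms by (simp add: power_int_add algebra_simps)
next
  case (Suc t)
  have "x powi (m - 2 * int t) = x\<^sup>2 * x powi (m - 2 * int (Suc t))"
    using assms power_int_add[of x 2 "m - 2 * int (Suc t)"] by simp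
  with Suc show ?case
    by (simp add: algebra_simps)
qed

theorem proposition4p3:
  fixes k s t :: nat and q :: real
  assumes "k \<ge> 1" and "s \<ge> 2" and "t \<ge> 1"
    and "q = (real k - 1) * (\<Sum>n=0..t. real k powi (- int s - 2 * int n))"
  shows "half_relation3 q
     (int k ^ (s - 2),
      (int k ^ (s - 2) + int k + 1) * int k ^ (2 * t + 2),
      int k + 1)"
proof (rule half_relation3I)
  have k: "real k \<noteq> 0"
    using assms(1) by simp
  define a where "a = real k ^ (s - 2)"
  define K where "K = real k ^ (2 * t + 2)"
  have a: "a = real k powi (int s - 2)"
    using assms(2) by (simp add: a_def power_int_def nat_diff_distrib)
  have K: "K = real k powi (2 * int t + 2)"
    by (simp add: K_def power_int_def nat_add_distrib nat_mult_distrib)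
  have "(real k + 1) * q =
      ((real k)\<^sup>2 - 1) * (\<Sum>n=0..t. real k powi (- int s - 2 * int n))"
    unfolding assms(4) by (simp add: algebra_simps power2_eq_square)
  also have "\<dots> = real k powi (- int s + 2) - real k powi (- int s - 2 * int t)"
    using k by (rule geometric_powi_telescope)
  finally have cq: "(real k + 1) * q = \<dots>" .
  have aKcq: "a * K * ((real k + 1) * q) = K - 1"
  proof -
    have "a * real k powi (- int s + 2) = 1"
      using k by (simp add: a flip: power_int_add)
    moreover have "a * K * real k powi (- int s - 2 * int t) = 1"
      using k by (simp add: a K flip: power_int_add)
    ultimately show ?thesis
      unfolding cq by (simp add: algebra_simps)
  qed
  have "a + (real k + 1) + a * ((a + real k + 1) * K) * (real k + 1) * q
      = a + (real k + 1) + (a + real k + 1) * (a * K * ((real k + 1) * q))"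
    by (simp only: ac_simps)
  also have "\<dots> = (a + real k + 1) * K"
    unfolding aKcq by (simp add: algebra_simps)
  finally show "real_of_int (int k ^ (s - 2)) + real_of_int (int k + 1)
      + real_of_int (int k ^ (s - 2))
        * real_of_int ((int k ^ (s - 2) + int k + 1) * int k ^ (2 * t + 2))
        * real_of_int (int k + 1) * q
      = real_of_int ((int k ^ (s - 2) + int k + 1) * int k ^ (2 * t + 2))"
    by (simp add: a_def K_def)
qed (use assms(1) in \<open>simp_all add: add_pos_pos\<close>)

end
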